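(* Let $d_1,d_2\ge1$ and let $(\mathbf{X}_1,\mathbf{Y}_1),\ldots,(\mathbf{X}_n,\mathbf{Y}_n)$ be i.i.d. from a probability distribution $\mu$ on $\mathbb{R}^{d_1+d_2}$ whose marginals satisfy $\mu_{\mathbf{X}}\in\mathcal{P}_{ac}(\mathbb{R}^{d_1})$ and $\mu_{\mathbf{Y}}\in\mathcal{P}_{ac}(\mathbb{R}^{d_2})$. Let $\mathcal{H}_n^{d_1}\subset[0,1]^{d_1}$ and $\mathcal{H}_n^{d_2}\subset[0,1]^{d_2}$ be fixed sets of $n$ points. Under $\mathrm{H}_0:\mu=\mu_{\mathbf{X}}\otimes\mu_{\mathbf{Y}}$, the distribution of $\mathrm{RdCov}_n^2$ is free of $\mu_{\mathbf{X}}$ and $\mu_{\mathbf{Y}}$ (i.e., it is the same for all such $\mu_{\mathbf{X}}$ and $\mu_{\mathbf{Y}}$).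
   Context: $\mathcal{P}_{ac}(\mathbb{R}^d)$: Lebesgue absolutely continuous probability measures on $\mathbb{R}^d$. $S_n$: permutations of $\{1,\ldots,n\}$. Empirical rank map: given data $\mathbf{X}_1,\ldots,\mathbf{X}_n\in\mathbb{R}^d$ and a fixed set $\{\mathbf{h}_1,\ldots,\mathbf{h}_n\}\subset[0,1]^d$, let $\hat\sigma\in\arg\min_{\sigma\in S_n}\sum_{i=1}^n\|\mathbf{X}_i-\mathbf{h}_{\sigma(i)}\|^2$ (almost surely unique); the empirical rank map sends $\mathbf{X}_i$ to $\mathbf{h}_{\hat\sigma(i)}$. Let $\hat R_n^{\mathbf{X}}$ be the empirical rank map of $\mathbf{X}_1,\ldots,\mathbf{X}_n$ with respect to $\mathcal{H}_n^{d_1}$ and $\hat R_n^{\mathbf{Y}}$ that of $\mathbf{Y}_1,\ldots,\mathbf{Y}_n$ with respect to $\mathcal{H}_n^{d_2}$. With $a_{kl}=\|\hat R_n^{\mathbf{X}}(\mathbf{X}_k)-\hat R_n^{\mathbf{X}}(\mathbf{X}_l)\|$ and $b_{kl}=\|\hat R_n^{\mathbf{Y}}(\mathbf{Y}_k)-\hat R_n^{\mathbf{Y}}(\mathbf{Y}_l)\|$, define $$\mathrm{RdCov}_n^2=\frac1{n^2}\sum_{k,l=1}^na_{kl}b_{kl}+\Big(\frac1{n^2}\sum_{k,l=1}^na_{kl}\Big)\Big(\frac1{n^2}\sum_{k,l=1}^nb_{kl}\Big)-\frac2{n^3}\sum_{k,l,m=1}^na_{kl}b_{km}.$$ *)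

theory Defs
  imports "HOL-Probability.Probability"
begin

definition P_ac :: "'a::euclidean_space measure set" where
  "P_ac = {\<nu>. prob_space \<nu> \<and> sets \<nu> = sets borel \<and> absolutely_continuous lborel \<nu>}"

definition iid_sample ::
    "'m measure \<Rightarrow> nat \<Rightarrow> (nat \<Rightarrow> 'm \<Rightarrow> 'z::topological_space) \<Rightarrow> 'z measure \<Rightarrow> bool" where
  "iid_sample M n Z \<mu> \<longleftrightarrow>
     prob_space M \<and>
     prob_space.indep_vars M (\<lambda>_. borel) Z {1..n} \<and>
     (\<forall>i\<in>{1..n}. distr M borel (Z i) = \<mu>)"

text \<open>
  The reference set is given by an enumeration \<open>h\<close> of its points. When the minimiser is not
  unique (which has probability zero for absolutely continuous data), \<open>ARG_MIN\<close> selects one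
  by a rule that depends only on the set of minimisers, so the selection is measurable.
\<close>

definition rank_perm :: "nat \<Rightarrow> (nat \<Rightarrow> 'a::euclidean_space) \<Rightarrow> (nat \<Rightarrow> 'a) \<Rightarrow> nat \<Rightarrow> nat" where
  "rank_perm n h x =
     (ARG_MIN (\<lambda>\<sigma>. \<Sum>i=1..n. (norm (x i - h (\<sigma> i)))\<^sup>2) \<sigma>. \<sigma> permutes {1..n})"

text \<open>
  For pairwise distinct data (again an almost sure event) this is the map sending \<open>x i\<close>
  to \<open>h (rank_perm n h x i)\<close>; see \<open>rank_map_data\<close> below. Values off the data points are
  irrelevant.
\<close>

definition rank_map :: "nat \<Rightarrow> (nat \<Rightarrow> 'a::euclidean_space) \<Rightarrow> (nat \<Rightarrow> 'a) \<Rightarrow> 'a \<Rightarrow> 'a" where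
  "rank_map n h x z = h (rank_perm n h x (inv_into {1..n} x z))"

definition RdCov_sq ::
    "nat \<Rightarrow> (nat \<Rightarrow> 'a::euclidean_space) \<Rightarrow> (nat \<Rightarrow> 'b::euclidean_space) \<Rightarrow>
     (nat \<Rightarrow> 'a) \<Rightarrow> (nat \<Rightarrow> 'b) \<Rightarrow> real" where
  "RdCov_sq n h1 h2 x y =
    (let a = (\<lambda>k l. norm (rank_map n h1 x (x k) - rank_map n h1 x (x l)));
         b = (\<lambda>k l. norm (rank_map n h2 y (y k) - rank_map n h2 y (y l)))
     in 1 / real n ^ 2 * (\<Sum>k=1..n. \<Sum>l=1..n. a k l * b k l)
        + (1 / real n ^ 2 * (\<Sum>k=1..n. \<Sum>l=1..n. a k l))
          * (1 / real n ^ 2 * (\<Sum>k=1..n. \<Sum>l=1..n. b k l))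
        - 2 / real n ^ 3 * (\<Sum>k=1..n. \<Sum>l=1..n. \<Sum>m=1..n. a k l * b k m))"

lemma rank_perm_is_arg_min:
  "is_arg_min (\<lambda>\<sigma>. \<Sum>i=1..n. (norm (x i - h (\<sigma> i)))\<^sup>2) (\<lambda>\<sigma>. \<sigma> permutes {1..n})
     (rank_perm n h x)"
proof -
  let ?f = "\<lambda>\<sigma>. \<Sum>i=1..n. (norm (x i - h (\<sigma> i)))\<^sup>2"
  let ?S = "{\<sigma>. \<sigma> permutes {1..n}}"
  have "finite ?S" by (simp add: finite_permutations)
  moreover have "id \<in> ?S" by (simp add: permutes_id)
  then have "?S \<noteq> {}" by blast
  ultimately have "\<exists>\<sigma>. is_arg_min ?f (\<lambda>\<sigma>. \<sigma> \<in> ?S) \<sigma>"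
    by (rule ex_is_arg_min_if_finite)
  then show ?thesis
    unfolding rank_perm_def arg_min_def mem_Collect_eq by (rule someI_ex)
qed

lemma rank_map_data:
  assumes "inj_on x {1..n}" "i \<in> {1..n}"
  shows "rank_map n h x (x i) = h (rank_perm n h x i)"
  using assms by (simp add: rank_map_def inv_into_f_f)

lemma measurable_finite_Collect:
  assumes "finite A" "\<And>s. s \<in> A \<Longrightarrow> Measurable.pred M (Q s)"
  shows "(\<lambda>\<omega>. {s \<in> A. Q s \<omega>}) \<in> measurable M (count_space (Pow A))"
proof (subst measurable_count_space_eq2)
  show "finite (Pow A)" using assms by simp
  have "(\<lambda>\<omega>. {s \<in> A. Q s \<omega>}) -` {B} \<inter> space M \<in> sets M" if "B \<in> Pow A" for B
  proof -
    have "Measurable.pred M (\<lambda>\<omega>. \<forall>s\<in>A. Q s \<omega> \<longleftrightarrow> s \<in> B)"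
      by (rule pred_intros_finite(3)[OF assms(1)]) (use assms(2) in measurable)
    moreover have "(\<lambda>\<omega>. {s \<in> A. Q s \<omega>}) -` {B} \<inter> space M
        = {\<omega> \<in> space M. \<forall>s\<in>A. Q s \<omega> \<longleftrightarrow> s \<in> B}"
      using that by auto
    ultimately show ?thesis by (simp add: pred_def)
  qed
  then show "(\<lambda>\<omega>. {s \<in> A. Q s \<omega>}) \<in> space M \<rightarrow> Pow A \<and>
      (\<forall>a\<in>Pow A. (\<lambda>\<omega>. {s \<in> A. Q s \<omega>}) -` {a} \<inter> space M \<in> sets M)"
    by auto
qed

lemma measurable_rank_perm:
  assumes [measurable]: "\<And>i. i \<in> {1..n} \<Longrightarrow> X i \<in> borel_measurable M"
  shows "(\<lambda>\<omega>. rank_perm n h (\<lambda>i. X i \<omega>)) \<in> measurable M (count_space UNIV)"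
proof -
  let ?A = "{\<sigma>. \<sigma> permutes {1..n}}"
  let ?f = "\<lambda>\<omega> \<sigma>. \<Sum>i=1..n. (norm (X i \<omega> - h (\<sigma> i)))\<^sup>2"
  let ?Q = "\<lambda>\<sigma> \<omega>. \<forall>\<tau>\<in>?A. \<not> ?f \<omega> \<tau> < ?f \<omega> \<sigma>"
  have fin: "finite ?A" by (simp add: finite_permutations)
  have "(\<lambda>\<omega>. {\<sigma> \<in> ?A. ?Q \<sigma> \<omega>}) \<in> measurable M (count_space (Pow ?A))"
    by (rule measurable_finite_Collect[OF fin], rule pred_intros_finite(3)[OF fin]) measurable
  moreover have "(\<lambda>B. SOME \<sigma>. \<sigma> \<in> B) \<in> measurable (count_space (Pow ?A)) (count_space UNIV)"
    by simp
  ultimately have "(\<lambda>\<omega>. SOME \<sigma>. \<sigma> \<in> {\<sigma> \<in> ?A. ?Q \<sigma> \<omega>}) \<in> measurable M (count_space UNIV)"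
    by (rule measurable_compose)
  moreover have "(SOME \<sigma>. \<sigma> \<in> {\<sigma> \<in> ?A. ?Q \<sigma> \<omega>}) = rank_perm n h (\<lambda>i. X i \<omega>)" for \<omega>
    unfolding rank_perm_def arg_min_def is_arg_min_def by (rule arg_cong[where f=Eps]) auto
  ultimately show ?thesis by simp
qed

lemma measurable_rank_map:
  assumes [measurable]: "\<And>i. i \<in> {1..n} \<Longrightarrow> X i \<in> borel_measurable M" and k: "k \<in> {1..n}"
  shows "(\<lambda>\<omega>. rank_map n h (\<lambda>i. X i \<omega>) (X k \<omega>)) \<in> borel_measurable M"
proof -
  have [measurable]: "X k \<in> borel_measurable M" using assms by blast
  have "(\<lambda>\<omega>. {i \<in> {1..n}. X i \<omega> = X k \<omega>}) \<in> measurable M (count_space (Pow {1..n}))"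
    by (rule measurable_finite_Collect) measurable
  moreover have "(\<lambda>B. SOME i. i \<in> B) \<in> measurable (count_space (Pow {1..n})) (count_space UNIV)"
    by simp
  ultimately have "(\<lambda>\<omega>. SOME i. i \<in> {i \<in> {1..n}. X i \<omega> = X k \<omega>}) \<in> measurable M (count_space UNIV)"
    by (rule measurable_compose)
  then have [measurable]:
    "(\<lambda>\<omega>. inv_into {1..n} (\<lambda>i. X i \<omega>) (X k \<omega>)) \<in> measurable M (count_space UNIV)"
    by (simp add: inv_into_def)
  have perm: "(\<lambda>\<omega>. rank_perm n h (\<lambda>i. X i \<omega>)) \<in> measurable M (count_space UNIV)"
    by (rule measurable_rank_perm) (rule assms)
  have "(\<lambda>\<omega>. h (rank_perm n h (\<lambda>i. X i \<omega>) j)) \<in> borel_measurable M" for j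
    by (rule measurable_compose[OF perm]) simp
  then show ?thesis
    unfolding rank_map_def
    by (rule measurable_compose_countable[where g = "\<lambda>\<omega>. inv_into {1..n} (\<lambda>i. X i \<omega>) (X k \<omega>)"])
      measurable
qed

lemma measurable_RdCov_sq:
  assumes X: "\<And>i. i \<in> {1..n} \<Longrightarrow> X i \<in> borel_measurable M"
    and Y: "\<And>i. i \<in> {1..n} \<Longrightarrow> Y i \<in> borel_measurable M"
  shows "(\<lambda>\<omega>. RdCov_sq n h1 h2 (\<lambda>i. X i \<omega>) (\<lambda>i. Y i \<omega>)) \<in> borel_measurable M"
proof -
  note [measurable] = measurable_rank_map[where X = X, OF X] measurable_rank_map[where X = Y, OF Y]
  show ?thesis unfolding RdCov_sq_def Let_def by measurable
qed

end

theory Submission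
  imports Defs
begin

text \<open>
  Two distinct permutations have equal cost only if the data satisfy a nontrivial linear
  equation, so for absolutely continuous data all costs are almost surely distinct. The rank
  permutation is then equivariant under relabelling the data. Since a product measure with equal
  factors is invariant under relabelling, the rank permutation is uniformly distributed on the
  symmetric group, whatever the marginal. Under independence the vectors of the \<open>X i\<close> and of
  the \<open>Y i\<close> are independent, so the pair of rank permutations is uniform on pairs, and the
  statistic is almost surely a fixed function of that pair.
\<close>

section \<open>Assignment costs and sample distance covariance\<close>

definition rank_cost :: "nat \<Rightarrow> (nat \<Rightarrow> 'a::euclidean_space) \<Rightarrow> (nat \<Rightarrow> 'a) \<Rightarrow> (nat \<Rightarrow> nat) \<Rightarrow> real" where
  "rank_cost n h x \<sigma> = (\<Sum>i=1..n. (norm (x i - h (\<sigma> i)))\<^sup>2)"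

text \<open>All costs are required to differ, which is more than uniqueness of the minimiser: this
  form reduces to one linear condition per pair of permutations, and it also rules out coinciding
  data points.\<close>

definition no_ties :: "nat \<Rightarrow> (nat \<Rightarrow> 'a::euclidean_space) \<Rightarrow> (nat \<Rightarrow> 'a) \<Rightarrow> bool" where
  "no_ties n h x \<longleftrightarrow> inj_on (rank_cost n h x) {\<sigma>. \<sigma> permutes {1..n}}"

text \<open>The squared sample distance covariance of arbitrary vectors. Separating it from the rank
  maps allows its evaluation at fixed permutations of the reference points.\<close>

definition dcov_sq ::
    "nat \<Rightarrow> (nat \<Rightarrow> 'a::real_normed_vector) \<Rightarrow> (nat \<Rightarrow> 'b::real_normed_vector) \<Rightarrow> real" where
  "dcov_sq n u v =
    1 / real n ^ 2 * (\<Sum>k=1..n. \<Sum>l=1..n. norm (u k - u l) * norm (v k - v l))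
    + (1 / real n ^ 2 * (\<Sum>k=1..n. \<Sum>l=1..n. norm (u k - u l)))
      * (1 / real n ^ 2 * (\<Sum>k=1..n. \<Sum>l=1..n. norm (v k - v l)))
    - 2 / real n ^ 3 * (\<Sum>k=1..n. \<Sum>l=1..n. \<Sum>m=1..n. norm (u k - u l) * norm (v k - v m))"

lemma RdCov_sq_eq_dcov_sq:
  "RdCov_sq n h1 h2 x y =
    dcov_sq n (\<lambda>k. rank_map n h1 x (x k)) (\<lambda>k. rank_map n h2 y (y k))"
  unfolding RdCov_sq_def dcov_sq_def Let_def ..

lemma dcov_sq_cong:
  assumes "\<And>k. k \<in> {1..n} \<Longrightarrow> u k = u' k" "\<And>k. k \<in> {1..n} \<Longrightarrow> v k = v' k"
  shows "dcov_sq n u v = dcov_sq n u' v'"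
  unfolding dcov_sq_def using assms
  by (intro arg_cong2[where f = "(-)"] arg_cong2[where f = "(+)"] arg_cong2[where f = "(*)"] refl
      sum.cong) simp_all

section \<open>Minimising permutations and relabelling of the data\<close>

lemma rank_perm_permutes: "rank_perm n h x permutes {1..n}"
  using rank_perm_is_arg_min[where n = n and x = x and h = h] by (simp add: is_arg_min_def)

lemma rank_cost_rank_perm_le:
  "\<sigma> permutes {1..n} \<Longrightarrow> rank_cost n h x (rank_perm n h x) \<le> rank_cost n h x \<sigma>"
  using rank_perm_is_arg_min[where n = n and x = x and h = h] by (simp add: is_arg_min_def rank_cost_def not_less)

lemma rank_perm_cong:
  assumes "\<And>i. i \<in> {1..n} \<Longrightarrow> x i = y i"
  shows "rank_perm n h x = rank_perm n h y"
proof -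
  have "(\<lambda>\<sigma>. \<Sum>i=1..n. (norm (x i - h (\<sigma> i)))\<^sup>2) = (\<lambda>\<sigma>. \<Sum>i=1..n. (norm (y i - h (\<sigma> i)))\<^sup>2)"
    by (intro ext sum.cong refl) (simp add: assms)
  then show ?thesis by (simp add: rank_perm_def)
qed

lemma rank_map_cong:
  assumes "\<And>i. i \<in> {1..n} \<Longrightarrow> x i = y i"
  shows "rank_map n h x = rank_map n h y"
proof -
  \<comment> \<open>\<open>inv_into\<close> chooses by \<open>SOME\<close> among the indices in
    \<open>{1..n}\<close>, so agreement there gives the same choice even when data points
    coincide.\<close>
  have "inv_into {1..n} x = inv_into {1..n} y"
    unfolding inv_into_def using assms by (intro ext arg_cong[where f = Eps]) auto
  moreover have "rank_perm n h x = rank_perm n h y" by (rule rank_perm_cong) (rule assms)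
  ultimately show ?thesis by (simp add: rank_map_def fun_eq_iff)
qed

text \<open>Permits replacing a sample by its restriction to \<open>{1..n}\<close>, the form that
  points of a product space take.\<close>

lemma RdCov_sq_cong:
  assumes "\<And>i. i \<in> {1..n} \<Longrightarrow> x i = x' i" "\<And>i. i \<in> {1..n} \<Longrightarrow> y i = y' i"
  shows "RdCov_sq n h1 h2 x y = RdCov_sq n h1 h2 x' y'"
proof -
  have "rank_map n h1 x = rank_map n h1 x'" "rank_map n h2 y = rank_map n h2 y'"
    by (rule rank_map_cong; rule assms; assumption)+
  then show ?thesis
    unfolding RdCov_sq_eq_dcov_sq by (intro dcov_sq_cong) (simp_all add: assms del: One_nat_def)
qed

text \<open>If two data points coincide, swapping their images does not change the cost.\<close>

lemma no_ties_imp_inj_on: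
  assumes "no_ties n h x"
  shows "inj_on x {1..n}"
proof (rule inj_onI, rule ccontr)
  fix i j assume ij: "i \<in> {1..n}" "j \<in> {1..n}" "x i = x j" "i \<noteq> j"
  let ?t = "Transposition.transpose i j"
  have t: "?t permutes {1..n}" using ij by (simp add: permutes_swap_id)
  have "rank_cost n h x ?t = (\<Sum>k=1..n. (norm (x (?t k) - h (?t k)))\<^sup>2)"
    unfolding rank_cost_def using ij by (intro sum.cong refl) (auto simp: Transposition.transpose_def)
  also have "\<dots> = rank_cost n h x id"
    unfolding rank_cost_def id_apply
    using sum.permute[OF t, of "\<lambda>k. (norm (x k - h k))\<^sup>2"] by (simp add: comp_def)
  finally have "?t = id"
    using assms t permutes_id[of "{1..n}"] unfolding no_ties_def by (auto dest: inj_onD)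
  then show False using ij by (metis id_apply transpose_apply_first)
qed

text \<open>Composing both the data and the assignment with \<open>\<tau>\<close> only reorders the
  summands of the cost. Hence minimisers correspond, and distinctness of the costs leaves no other
  choice.\<close>

lemma rank_perm_comp:
  assumes "no_ties n h x" and t: "\<tau> permutes {1..n}"
  shows "rank_perm n h (x \<circ> \<tau>) = rank_perm n h x \<circ> \<tau>"
proof -
  have cost: "rank_cost n h (x \<circ> \<tau>) (\<sigma> \<circ> \<tau>) = rank_cost n h x \<sigma>" for \<sigma>
    unfolding rank_cost_def
    using sum.permute[OF t, of "\<lambda>k. (norm (x k - h (\<sigma> k)))\<^sup>2"] by (simp add: comp_def)
  \<comment> \<open>The optimal assignment for the relabelled data, pulled back to a competitor for
    \<open>x\<close>.\<close>
  define \<rho> where "\<rho> = rank_perm n h (x \<circ> \<tau>) \<circ> inv \<tau>"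
  have \<rho>: "\<rho> permutes {1..n}"
    unfolding \<rho>_def by (intro permutes_compose permutes_inv t rank_perm_permutes)
  have eq: "rank_perm n h (x \<circ> \<tau>) = \<rho> \<circ> \<tau>"
    by (simp add: \<rho>_def comp_assoc permutes_inv_o[OF t])
  have "rank_cost n h x \<rho> = rank_cost n h (x \<circ> \<tau>) (rank_perm n h (x \<circ> \<tau>))"
    by (simp add: eq cost)
  also have "\<dots> \<le> rank_cost n h (x \<circ> \<tau>) (rank_perm n h x \<circ> \<tau>)"
    by (intro rank_cost_rank_perm_le permutes_compose t rank_perm_permutes)
  also have "\<dots> = rank_cost n h x (rank_perm n h x)" by (rule cost)
  finally have "rank_cost n h x \<rho> = rank_cost n h x (rank_perm n h x)"
    using rank_cost_rank_perm_le[OF \<rho>, of h x] by simp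
  then have "\<rho> = rank_perm n h x"
    using assms(1) \<rho> rank_perm_permutes[of n h x] unfolding no_ties_def by (auto dest: inj_onD)
  then show ?thesis by (simp add: eq)
qed

text \<open>Absence of ties forces distinct data, so the index lookup in \<open>rank_map\<close> is
  exact and the data enter only through the two rank permutations.\<close>

lemma RdCov_sq_eq_rank_perm:
  assumes "no_ties n h1 x" "no_ties n h2 y"
  shows "RdCov_sq n h1 h2 x y = dcov_sq n (h1 \<circ> rank_perm n h1 x) (h2 \<circ> rank_perm n h2 y)"
  unfolding RdCov_sq_eq_dcov_sq
  by (rule dcov_sq_cong) (simp_all add: rank_map_data no_ties_imp_inj_on[OF assms(1)]
      no_ties_imp_inj_on[OF assms(2)] del: One_nat_def)

section \<open>Almost sure absence of ties\<close>

lemma pred_no_ties: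
  fixes h :: "nat \<Rightarrow> 'a::euclidean_space"
  assumes [measurable]: "\<And>i. i \<in> {1..n} \<Longrightarrow> X i \<in> borel_measurable M"
  shows "Measurable.pred M (\<lambda>\<omega>. no_ties n h (\<lambda>i. X i \<omega>))"
proof -
  have fin: "finite {\<sigma>. \<sigma> permutes {1..n}}" by (simp add: finite_permutations)
  have [measurable]: "(\<lambda>\<omega>. rank_cost n h (\<lambda>i. X i \<omega>) \<sigma>) \<in> borel_measurable M" for \<sigma>
    unfolding rank_cost_def by measurable
  show ?thesis
    unfolding no_ties_def inj_on_def
    by (intro pred_intros_finite(3)[OF fin]) measurable
qed

text \<open>A hyperplane is Lebesgue null, and absolute continuity passes this on to
  \<open>\<nu>\<close>.\<close>

lemma P_ac_AE_inner_neq: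
  fixes \<nu> :: "'a::euclidean_space measure"
  assumes "\<nu> \<in> P_ac" "v \<noteq> 0"
  shows "AE y in \<nu>. v \<bullet> y \<noteq> c"
proof -
  have "negligible {y. v \<bullet> y = c}" using assms(2) by (intro negligible_hyperplane) simp
  then have "{y. v \<bullet> y = c} \<in> null_sets lborel"
    by (simp add: negligible_iff_null_sets null_sets_completion_iff)
  then have "{y. v \<bullet> y = c} \<in> null_sets \<nu>"
    using assms(1) by (auto simp: P_ac_def absolutely_continuous_def)
  then show ?thesis by (rule AE_I') auto
qed

text \<open>Tonelli: the indicator of the exceptional set is integrated over coordinate
  \<open>i\<close> first, where it already vanishes for each choice of the other
  coordinates.\<close>

lemma AE_PiM_insert:
  assumes "\<And>i. sigma_finite_measure (N i)" "finite J" "i \<notin> J"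
    and P[measurable]: "Measurable.pred (PiM (insert i J) N) P"
    and AE: "\<And>x. x \<in> space (PiM J N) \<Longrightarrow> AE y in N i. P (x(i := y))"
  shows "AE x in PiM (insert i J) N. P x"
proof -
  interpret product_sigma_finite N using assms(1) by (simp add: product_sigma_finite_def)
  have "(\<integral>\<^sup>+x. indicator {x. \<not> P x} x \<partial>PiM (insert i J) N)
      = (\<integral>\<^sup>+x. (\<integral>\<^sup>+y. indicator {x. \<not> P x} (x(i := y)) \<partial>N i) \<partial>PiM J N)"
    using assms(2,3) by (intro product_nn_integral_insert) measurable
  also have "\<dots> = (\<integral>\<^sup>+x. 0 \<partial>PiM J N)"
  proof (rule nn_integral_cong)
    fix x assume "x \<in> space (PiM J N)"
    from AE[OF this] have "AE y in N i. indicator {x. \<not> P x} (x(i := y)) = (0::ennreal)"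
      by eventually_elim simp
    then show "(\<integral>\<^sup>+y. indicator {x. \<not> P x} (x(i := y)) \<partial>N i) = 0"
      by (subst nn_integral_cong_AE[where v = "\<lambda>_. 0"]) simp_all
  qed
  finally have "(\<integral>\<^sup>+x. indicator {x. \<not> P x} x \<partial>PiM (insert i J) N) = 0" by simp
  then have "AE x in PiM (insert i J) N. indicator {x. \<not> P x} x = (0::ennreal)"
    by (subst (asm) nn_integral_0_iff_AE) measurable
  then show ?thesis by eventually_elim (simp add: indicator_def split: if_splits)
qed

text \<open>After expanding the squares, the terms in \<open>x\<close> alone are common to both
  costs, and so are the terms in \<open>h\<close> alone, up to reordering. Only the cross terms,
  linear in \<open>x\<close>, can differ.\<close>

lemma rank_cost_eq_iff:
  assumes "\<sigma> permutes {1..n}" "\<tau> permutes {1..n}"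
  shows "rank_cost n h x \<sigma> = rank_cost n h x \<tau> \<longleftrightarrow> (\<Sum>i=1..n. (h (\<sigma> i) - h (\<tau> i)) \<bullet> x i) = 0"
proof -
  have expand: "rank_cost n h x \<rho>
      = (\<Sum>i=1..n. (norm (x i))\<^sup>2) - 2 * (\<Sum>i=1..n. h (\<rho> i) \<bullet> x i) + (\<Sum>i=1..n. (norm (h i))\<^sup>2)"
    if "\<rho> permutes {1..n}" for \<rho>
  proof -
    have "rank_cost n h x \<rho> = (\<Sum>i=1..n. (norm (x i))\<^sup>2 - 2 * (h (\<rho> i) \<bullet> x i) + (norm (h (\<rho> i)))\<^sup>2)"
      unfolding rank_cost_def power2_norm_eq_inner
      by (intro sum.cong refl) (simp add: inner_diff inner_commute)
    also have "(\<Sum>i=1..n. (norm (h (\<rho> i)))\<^sup>2) = (\<Sum>i=1..n. (norm (h i))\<^sup>2)"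
      using sum.permute[OF that, of "\<lambda>i. (norm (h i))\<^sup>2"] by (simp add: comp_def)
    then have "(\<Sum>i=1..n. (norm (x i))\<^sup>2 - 2 * (h (\<rho> i) \<bullet> x i) + (norm (h (\<rho> i)))\<^sup>2)
      = (\<Sum>i=1..n. (norm (x i))\<^sup>2) - 2 * (\<Sum>i=1..n. h (\<rho> i) \<bullet> x i) + (\<Sum>i=1..n. (norm (h i))\<^sup>2)"
      by (simp add: sum.distrib sum_subtractf sum_distrib_left)
    finally show ?thesis .
  qed
  show ?thesis
    by (simp add: expand assms inner_diff_left sum_subtractf del: One_nat_def)
qed

text \<open>Two different permutations disagree at some index \<open>i\<close>, where injectivity of
  \<open>h\<close> gives \<open>x i\<close> a nonzero coefficient in the tie equation. With the
  other coordinates fixed, a tie confines \<open>x i\<close> to a hyperplane. There are only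
  finitely many pairs of permutations.\<close>

lemma AE_no_ties:
  fixes h :: "nat \<Rightarrow> 'a::euclidean_space"
  assumes \<nu>: "\<nu> \<in> P_ac" and h: "inj_on h {1..n}"
  shows "AE x in PiM {1..n} (\<lambda>_. \<nu>). no_ties n h x"
proof -
  interpret \<nu>: prob_space \<nu> using \<nu> by (simp add: P_ac_def)
  have [measurable_cong]: "sets \<nu> = sets borel" using \<nu> by (simp add: P_ac_def)
  let ?P = "{\<sigma>. \<sigma> permutes {1..n}}"
  have fin: "finite ?P" by (simp add: finite_permutations)
  have cost: "(\<lambda>x. rank_cost n h x \<rho>) \<in> borel_measurable (PiM {1..n} (\<lambda>_. \<nu>))" for \<rho>
    unfolding rank_cost_def by (intro borel_measurable_sum) measurable
  have ne: "AE x in PiM {1..n} (\<lambda>_. \<nu>). rank_cost n h x \<sigma> \<noteq> rank_cost n h x \<tau>"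
    if \<sigma>: "\<sigma> \<in> ?P" and \<tau>: "\<tau> \<in> ?P" and neq: "\<sigma> \<noteq> \<tau>" for \<sigma> \<tau>
  proof -
    obtain i where i: "\<sigma> i \<noteq> \<tau> i" using neq by auto
    then have iI: "i \<in> {1..n}" using \<sigma> \<tau> by (metis mem_Collect_eq permutes_not_in)
    define v where "v = h (\<sigma> i) - h (\<tau> i)"
    have "\<sigma> i \<in> {1..n}" "\<tau> i \<in> {1..n}"
      using \<sigma> \<tau> iI permutes_in_image by (metis mem_Collect_eq)+
    then have v: "v \<noteq> 0" using i h by (auto simp: v_def dest: inj_onD)
    define J where "J = {1..n} - {i}"
    have IJ: "{1..n} = insert i J" "i \<notin> J" "finite J" using iI by (auto simp: J_def)
    have "AE x in PiM (insert i J) (\<lambda>_. \<nu>). rank_cost n h x \<sigma> \<noteq> rank_cost n h x \<tau>"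
    proof (rule AE_PiM_insert)
      show "Measurable.pred (PiM (insert i J) (\<lambda>_. \<nu>)) (\<lambda>x. rank_cost n h x \<sigma> \<noteq> rank_cost n h x \<tau>)"
        unfolding IJ(1)[symmetric] pred_def by (rule borel_measurable_neq[OF cost cost])
      fix x
      \<comment> \<open>Isolates the dependence on coordinate \<open>i\<close>; the remaining sum is
        constant in \<open>y\<close>.\<close>
      have split: "v \<bullet> y + (\<Sum>j\<in>J. (h (\<sigma> j) - h (\<tau> j)) \<bullet> x j)
          = (\<Sum>j=1..n. (h (\<sigma> j) - h (\<tau> j)) \<bullet> (x(i := y)) j)" for y
        unfolding IJ(1) using IJ(2,3) by (auto simp: v_def intro!: sum.cong)
      have "rank_cost n h (x(i := y)) \<sigma> \<noteq> rank_cost n h (x(i := y)) \<tau>"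
        if "v \<bullet> y \<noteq> - (\<Sum>j\<in>J. (h (\<sigma> j) - h (\<tau> j)) \<bullet> x j)" for y
        using that \<sigma> \<tau> rank_cost_eq_iff[of \<sigma> n \<tau> h "x(i := y)"] split[of y] by auto
      with P_ac_AE_inner_neq[OF \<nu> v, of "- (\<Sum>j\<in>J. (h (\<sigma> j) - h (\<tau> j)) \<bullet> x j)"]
      show "AE y in \<nu>. rank_cost n h (x(i := y)) \<sigma> \<noteq> rank_cost n h (x(i := y)) \<tau>"
        by (auto elim: eventually_mono)
    qed (use IJ in \<open>auto intro: \<nu>.sigma_finite_measure_axioms\<close>)
    then show ?thesis unfolding IJ(1) .
  qed
  have "AE x in PiM {1..n} (\<lambda>_. \<nu>). \<forall>\<sigma>\<in>?P. \<forall>\<tau>\<in>?P. \<sigma> \<noteq> \<tau> \<longrightarrow> rank_cost n h x \<sigma> \<noteq> rank_cost n h x \<tau>"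
  proof (intro AE_finite_allI fin)
    fix \<sigma> \<tau> assume "\<sigma> \<in> ?P" "\<tau> \<in> ?P"
    then show "AE x in PiM {1..n} (\<lambda>_. \<nu>). \<sigma> \<noteq> \<tau> \<longrightarrow> rank_cost n h x \<sigma> \<noteq> rank_cost n h x \<tau>"
      using ne by (cases "\<sigma> = \<tau>") auto
  qed
  then show ?thesis by eventually_elim (auto simp: no_ties_def inj_on_def)
qed

section \<open>Exchangeability and uniformity of the rank permutation\<close>

lemma distr_PiM_permutes:
  assumes "prob_space \<nu>" "\<tau> permutes I"
  shows "distr (PiM I (\<lambda>_. \<nu>)) (PiM I (\<lambda>_. \<nu>)) (\<lambda>x. x \<circ> \<tau>) = PiM I (\<lambda>_. \<nu>)"
proof -
  have "distr (PiM I (\<lambda>_. \<nu>)) (PiM I (\<lambda>_. \<nu>)) (\<lambda>x. x \<circ> \<tau>)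
      = distr (PiM I (\<lambda>_. \<nu>)) (PiM I (\<lambda>_. \<nu>)) (\<lambda>x. \<lambda>i\<in>I. x (\<tau> i))"
  proof (intro distr_cong refl ext)
    fix x i assume x: "x \<in> space (PiM I (\<lambda>_. \<nu>))"
    \<comment> \<open>Points of the product space are \<open>undefined\<close> outside
      \<open>I\<close>, and \<open>\<tau>\<close> fixes those indices, so
      \<open>x \<circ> \<tau>\<close> is already restricted to \<open>I\<close>.\<close>
    show "(x \<circ> \<tau>) i = (\<lambda>i\<in>I. x (\<tau> i)) i"
      using PiE_arb[OF x[unfolded space_PiM], of i] permutes_not_in[OF assms(2), of i]
      by (cases "i \<in> I") simp_all
  qed
  also have "\<dots> = PiM I (\<lambda>_. \<nu>)"
    using distr_PiM_reindex[of I "\<lambda>_. \<nu>" \<tau> I] assms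
    by (auto intro: permutes_inj_on simp: permutes_in_image)
  finally show ?thesis .
qed

lemma measurable_rank_perm_PiM:
  assumes "sets \<nu> = sets borel"
  shows "rank_perm n h \<in> measurable (PiM {1..n} (\<lambda>_. \<nu>)) (count_space {\<sigma>. \<sigma> permutes {1..n}})"
proof -
  have "rank_perm n h \<in> measurable (PiM {1..n} (\<lambda>_. \<nu>)) (count_space UNIV)"
    using measurable_rank_perm[of n "\<lambda>i x. x i" "PiM {1..n} (\<lambda>_. \<nu>)" h] assms
    by (simp add: measurable_component_singleton cong: measurable_cong_sets)
  then show ?thesis
    by (subst measurable_count_space_eq2)
      (auto simp: finite_permutations rank_perm_permutes simp del: One_nat_def intro: measurable_sets)
qed

text \<open>Relabelling the data by \<open>\<sigma>\<close> preserves the product measure and almost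
  surely composes the rank permutation with \<open>\<sigma>\<close>. So every atom has the mass of
  the atom at \<open>id\<close>, and these equal masses sum to 1.\<close>

lemma distr_rank_perm:
  fixes h :: "nat \<Rightarrow> 'a::euclidean_space"
  assumes \<nu>: "\<nu> \<in> P_ac" and h: "inj_on h {1..n}"
  shows "distr (PiM {1..n} (\<lambda>_. \<nu>)) (count_space {\<sigma>. \<sigma> permutes {1..n}}) (rank_perm n h)
    = uniform_count_measure {\<sigma>. \<sigma> permutes {1..n}}"
proof -
  interpret \<nu>: prob_space \<nu> using \<nu> by (simp add: P_ac_def)
  have sets\<nu>: "sets \<nu> = sets borel" using \<nu> by (simp add: P_ac_def)
  let ?P = "{\<sigma>. \<sigma> permutes {1..n}}" and ?N = "PiM {1..n} (\<lambda>_. \<nu>)"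
  interpret N: prob_space ?N by (intro prob_space_PiM \<nu>.prob_space_axioms)
  have fin: "finite ?P" by (simp add: finite_permutations)
  note meas = measurable_rank_perm_PiM[OF sets\<nu>, of n h]
  let ?D = "distr ?N (count_space ?P) (rank_perm n h)"
  interpret D: prob_space ?D by (rule N.prob_space_distr) (rule meas)
  have eq: "emeasure ?D {\<sigma>} = emeasure ?D {id}" if \<sigma>: "\<sigma> \<in> ?P" for \<sigma>
  proof -
    have \<sigma>p: "\<sigma> permutes {1..n}" using \<sigma> by simp
    have shift: "(\<lambda>x. x \<circ> \<sigma>) \<in> measurable ?N ?N"
    proof (rule measurable_PiM_single')
      show "(\<lambda>x. (x \<circ> \<sigma>) i) \<in> measurable ?N \<nu>" if "i \<in> {1..n}" for i
        using that permutes_in_image[OF \<sigma>p] by (auto intro!: measurable_component_singleton)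
      show "(\<lambda>x. x \<circ> \<sigma>) \<in> space ?N \<rightarrow> (\<Pi>\<^sub>E i\<in>{1..n}. space \<nu>)"
      proof (intro Pi_I PiE_I)
        fix x i assume x: "x \<in> space ?N"
        show "(x \<circ> \<sigma>) i \<in> space \<nu>" if "i \<in> {1..n}"
          using x that permutes_in_image[OF \<sigma>p, of i] by (auto simp: space_PiM dest: PiE_mem[of x _ _ "\<sigma> i"])
        show "(x \<circ> \<sigma>) i = undefined" if "i \<notin> {1..n}"
          using PiE_arb[OF x[unfolded space_PiM] that] permutes_not_in[OF \<sigma>p that] by simp
      qed
    qed
    have "(\<lambda>\<rho>. \<rho> \<circ> \<sigma>) \<in> measurable (count_space ?P) (count_space ?P)"
      by (rule measurable_count_space_eq1[THEN iffD2])
        (simp add: Pi_I permutes_compose[OF \<sigma>p] del: One_nat_def o_apply)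
    from measurable_compose[OF meas this]
    have comp: "(\<lambda>x. rank_perm n h x \<circ> \<sigma>) \<in> measurable ?N (count_space ?P)" .
    \<comment> \<open>Exchangeability is used backwards here: \<open>?N\<close> is replaced by its
      own image under relabelling.\<close>
    have "?D = distr (distr ?N ?N (\<lambda>x. x \<circ> \<sigma>)) (count_space ?P) (rank_perm n h)"
      by (subst distr_PiM_permutes[OF \<nu>.prob_space_axioms \<sigma>p]) (rule refl)
    also have "\<dots> = distr ?N (count_space ?P) (\<lambda>x. rank_perm n h (x \<circ> \<sigma>))"
      unfolding distr_distr[OF meas shift] comp_def[of "rank_perm n h"] ..
    also have "\<dots> = distr ?N (count_space ?P) (\<lambda>x. rank_perm n h x \<circ> \<sigma>)"
    proof (rule distr_cong_AE)
      show "AE x in ?N. rank_perm n h (x \<circ> \<sigma>) = rank_perm n h x \<circ> \<sigma>"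
        using AE_no_ties[OF \<nu> h] by eventually_elim (rule rank_perm_comp[OF _ \<sigma>p])
      show "(\<lambda>x. rank_perm n h (x \<circ> \<sigma>)) \<in> measurable ?N (count_space ?P)"
        by (rule measurable_compose[OF shift meas])
      show "(\<lambda>x. rank_perm n h x \<circ> \<sigma>) \<in> measurable ?N (count_space ?P)"
        by (rule comp)
    qed simp_all
    finally have "emeasure ?D {\<sigma>} = emeasure (distr ?N (count_space ?P) (\<lambda>x. rank_perm n h x \<circ> \<sigma>)) {\<sigma>}"
      by simp
    also have "\<dots> = emeasure ?N ((\<lambda>x. rank_perm n h x \<circ> \<sigma>) -` {\<sigma>} \<inter> space ?N)"
      by (rule emeasure_distr[OF comp]) (use \<sigma> in simp)
    \<comment> \<open>The surjection \<open>\<sigma>\<close> cancels on the right.\<close>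
    also have "(\<lambda>x. rank_perm n h x \<circ> \<sigma>) -` {\<sigma>} = rank_perm n h -` {id}"
    proof -
      have "\<rho> \<circ> \<sigma> = \<sigma> \<longleftrightarrow> \<rho> = id" for \<rho> :: "nat \<Rightarrow> nat"
        using permutes_surj[OF \<sigma>p] by (auto simp: fun_eq_iff) (metis surjD)
      then show ?thesis by auto
    qed
    also have "emeasure ?N (rank_perm n h -` {id} \<inter> space ?N) = emeasure ?D {id}"
      by (rule emeasure_distr[OF meas, symmetric]) (simp add: permutes_id)
    finally show ?thesis .
  qed
  show ?thesis
  proof (rule measure_eqI_finite[OF _ _ fin])
    fix \<sigma> assume \<sigma>: "\<sigma> \<in> ?P"
    have "1 = emeasure ?D ?P" using D.emeasure_space_1 by simp
    also have "\<dots> = (\<Sum>\<tau>\<in>?P. emeasure ?D {\<tau>})"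
      by (rule emeasure_eq_sum_singleton[OF fin]) auto
    also have "\<dots> = of_nat (card ?P) * emeasure ?D {\<sigma>}"
      by (subst sum.cong[OF refl eq]) (simp_all only: eq[OF \<sigma>] sum_constant)
    finally have *: "1 = of_nat (card ?P) * emeasure ?D {\<sigma>}" .
    have "card ?P > 0" using fin \<sigma> by (metis card_gt_0_iff empty_iff)
    then have "measure ?D {\<sigma>} = 1 / card ?P"
      using arg_cong[OF *, of enn2real] by (simp add: enn2real_mult field_simps measure_def)
    moreover have "emeasure (uniform_count_measure ?P) {\<sigma>} = ennreal (1 / card ?P)"
      using \<sigma> by (subst emeasure_uniform_count_measure[OF fin]) auto
    ultimately show "emeasure ?D {\<sigma>} = emeasure (uniform_count_measure ?P) {\<sigma>}"
      by (simp only: D.emeasure_eq_measure)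
  qed (simp_all add: sets_uniform_count_measure)
qed

section \<open>Joint law of the two samples under independence\<close>

text \<open>Independent pairs with independent components amount to two independent vectors zipped
  together. Both measures agree on boxes, which determine a finite product measure.\<close>

lemma PiM_pair_measure_eq_distr:
  assumes "prob_space M1" "prob_space M2" and I: "finite I"
  shows "PiM I (\<lambda>_. M1 \<Otimes>\<^sub>M M2) = distr (PiM I (\<lambda>_. M1) \<Otimes>\<^sub>M PiM I (\<lambda>_. M2))
    (PiM I (\<lambda>_. M1 \<Otimes>\<^sub>M M2)) (\<lambda>(x, y). \<lambda>i\<in>I. (x i, y i))"
proof -
  interpret M1: prob_space M1 by fact
  interpret M2: prob_space M2 by fact
  interpret P1: product_sigma_finite "\<lambda>_. M1"
    by (simp add: product_sigma_finite_def M1.sigma_finite_measure_axioms)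
  interpret P2: product_sigma_finite "\<lambda>_. M2"
    by (simp add: product_sigma_finite_def M2.sigma_finite_measure_axioms)
  interpret M12: prob_space "M1 \<Otimes>\<^sub>M M2"
    by (intro prob_space_pair M1.prob_space_axioms M2.prob_space_axioms)
  interpret P: product_sigma_finite "\<lambda>_. M1 \<Otimes>\<^sub>M M2"
    by (simp add: product_sigma_finite_def M12.sigma_finite_measure_axioms)
  interpret N2: prob_space "PiM I (\<lambda>_. M2)" by (intro prob_space_PiM M2.prob_space_axioms)
  let ?f = "\<lambda>(x, y). \<lambda>i\<in>I. (x i, y i)"
  have f: "?f \<in> measurable (PiM I (\<lambda>_. M1) \<Otimes>\<^sub>M PiM I (\<lambda>_. M2)) (PiM I (\<lambda>_. M1 \<Otimes>\<^sub>M M2))"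
    by measurable
  show ?thesis
  proof (rule P.PiM_eqI[OF I, symmetric])
    \<comment> \<open>The sides \<open>A i\<close> are arbitrary measurable sets of pairs, not only
      rectangles, so the computation goes through their sections at \<open>x i\<close>.\<close>
    fix A assume A: "\<And>i. i \<in> I \<Longrightarrow> A i \<in> sets (M1 \<Otimes>\<^sub>M M2)"
    have box: "Pi\<^sub>E I A \<in> sets (PiM I (\<lambda>_. M1 \<Otimes>\<^sub>M M2))"
      using A I by (intro sets_PiM_I_finite) auto
    let ?N1 = "PiM I (\<lambda>_. M1)" and ?N2 = "PiM I (\<lambda>_. M2)"
    have "emeasure (distr (?N1 \<Otimes>\<^sub>M ?N2) (PiM I (\<lambda>_. M1 \<Otimes>\<^sub>M M2)) ?f) (Pi\<^sub>E I A)
        = emeasure (?N1 \<Otimes>\<^sub>M ?N2) (?f -` Pi\<^sub>E I A \<inter> space (?N1 \<Otimes>\<^sub>M ?N2))"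
      by (rule emeasure_distr[OF f box])
    also have "\<dots> = (\<integral>\<^sup>+x. emeasure ?N2 (Pair x -` (?f -` Pi\<^sub>E I A \<inter> space (?N1 \<Otimes>\<^sub>M ?N2))) \<partial>?N1)"
      by (rule N2.emeasure_pair_measure_alt) (rule measurable_sets[OF f box])
    also have "\<dots> = (\<integral>\<^sup>+x. (\<Prod>i\<in>I. emeasure M2 (Pair (x i) -` A i)) \<partial>?N1)"
    proof (rule nn_integral_cong)
      fix x assume x: "x \<in> space ?N1"
      have sub: "Pair (x i) -` A i \<subseteq> space M2" if "i \<in> I" for i
        using sets.sets_into_space[OF A[OF that]] by (auto simp: space_pair_measure)
      \<comment> \<open>For fixed \<open>x\<close>, the section of a box is again a box;
        \<open>sub\<close> accounts for the intersection with the whole space.\<close>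
      have "Pair x -` (?f -` Pi\<^sub>E I A \<inter> space (?N1 \<Otimes>\<^sub>M ?N2)) = Pi\<^sub>E I (\<lambda>i. Pair (x i) -` A i)"
        using x sub by (auto simp: space_pair_measure space_PiM PiE_iff subset_iff)
      then show "emeasure ?N2 (Pair x -` (?f -` Pi\<^sub>E I A \<inter> space (?N1 \<Otimes>\<^sub>M ?N2)))
          = (\<Prod>i\<in>I. emeasure M2 (Pair (x i) -` A i))"
        using P2.emeasure_PiM[OF I, of "\<lambda>i. Pair (x i) -` A i"] A by (simp add: sets_Pair1)
    qed
    \<comment> \<open>Each factor depends on a single coordinate of \<open>x\<close>, so the
      integral factorises.\<close>
    also have "\<dots> = (\<Prod>i\<in>I. \<integral>\<^sup>+x. emeasure M2 (Pair x -` A i) \<partial>M1)"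
      using A by (intro P1.product_nn_integral_prod I M2.measurable_emeasure_Pair)
    also have "\<dots> = (\<Prod>i\<in>I. emeasure (M1 \<Otimes>\<^sub>M M2) (A i))"
      using A by (intro prod.cong refl M2.emeasure_pair_measure_alt[symmetric])
    finally show "emeasure (distr (?N1 \<Otimes>\<^sub>M ?N2) (PiM I (\<lambda>_. M1 \<Otimes>\<^sub>M M2)) ?f) (Pi\<^sub>E I A)
        = (\<Prod>i\<in>I. emeasure (M1 \<Otimes>\<^sub>M M2) (A i))" .
  qed simp
qed

text \<open>The right-hand side involves only \<open>n\<close>, \<open>h1\<close> and
  \<open>h2\<close>, so two applications, one per model, give distribution-freeness.\<close>

lemma distr_RdCov_sq:
  fixes h1 :: "nat \<Rightarrow> 'a::euclidean_space" and h2 :: "nat \<Rightarrow> 'b::euclidean_space"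
  assumes n: "n > 0" and h1: "inj_on h1 {1..n}" and h2: "inj_on h2 {1..n}"
    and \<mu>X: "\<mu>X \<in> P_ac" and \<mu>Y: "\<mu>Y \<in> P_ac"
    and iid: "iid_sample M n (\<lambda>i \<omega>. (X i \<omega>, Y i \<omega>)) (\<mu>X \<Otimes>\<^sub>M \<mu>Y)"
  shows "distr M borel (\<lambda>\<omega>. RdCov_sq n h1 h2 (\<lambda>i. X i \<omega>) (\<lambda>i. Y i \<omega>))
    = distr (uniform_count_measure {\<sigma>. \<sigma> permutes {1..n}} \<Otimes>\<^sub>M
        uniform_count_measure {\<sigma>. \<sigma> permutes {1..n}})
      borel (\<lambda>(\<sigma>, \<tau>). dcov_sq n (h1 \<circ> \<sigma>) (h2 \<circ> \<tau>))"
proof -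
  interpret M: prob_space M using iid by (simp add: iid_sample_def)
  interpret \<mu>X: prob_space \<mu>X using \<mu>X by (simp add: P_ac_def)
  interpret \<mu>Y: prob_space \<mu>Y using \<mu>Y by (simp add: P_ac_def)
  have sX [measurable_cong]: "sets \<mu>X = sets borel" using \<mu>X by (simp add: P_ac_def)
  have sY [measurable_cong]: "sets \<mu>Y = sets borel" using \<mu>Y by (simp add: P_ac_def)
  let ?I = "{1..n}" and ?P = "{\<sigma>. \<sigma> permutes {1..n}}"
  let ?NX = "PiM ?I (\<lambda>_. \<mu>X)" and ?NY = "PiM ?I (\<lambda>_. \<mu>Y)"
  interpret NX: prob_space ?NX by (intro prob_space_PiM \<mu>X.prob_space_axioms)
  interpret NY: prob_space ?NY by (intro prob_space_PiM \<mu>Y.prob_space_axioms)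
  interpret XY: pair_sigma_finite ?NX ?NY by unfold_locales
  let ?Z = "\<lambda>\<omega>. \<lambda>i\<in>?I. (X i \<omega>, Y i \<omega>)"
  define R where "R = (\<lambda>z. RdCov_sq n h1 h2 (\<lambda>i. fst (z i)) (\<lambda>i. snd (z i)))"
  have fin: "finite ?P" by (simp add: finite_permutations)
  \<comment> \<open>The sample is measured with \<open>borel\<close> on pairs, the null hypothesis
    with a product of sigma-algebras; the two sigma-algebras coincide.\<close>
  have sB: "sets (\<mu>X \<Otimes>\<^sub>M \<mu>Y) = sets (borel :: ('a \<times> 'b) measure)"
    unfolding borel_prod[symmetric] by (rule sets_pair_measure_cong[OF sX sY])
  have sPiM: "sets (PiM ?I (\<lambda>_. \<mu>X \<Otimes>\<^sub>M \<mu>Y)) = sets (PiM ?I (\<lambda>_. borel :: ('a \<times> 'b) measure))"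
    by (intro sets_PiM_cong refl sB)
  have rv: "(\<lambda>\<omega>. (X i \<omega>, Y i \<omega>)) \<in> borel_measurable M" if "i \<in> ?I" for i
    using iid that by (auto simp: iid_sample_def M.indep_vars_def)
  have Z: "?Z \<in> measurable M (PiM ?I (\<lambda>_. borel))"
    by (intro measurable_restrict rv)
  have R: "R \<in> borel_measurable (PiM ?I (\<lambda>_. borel))"
    unfolding R_def borel_prod[symmetric] by (intro measurable_RdCov_sq) measurable
  have R': "R \<in> borel_measurable (PiM ?I (\<lambda>_. \<mu>X \<Otimes>\<^sub>M \<mu>Y))"
    using R unfolding measurable_cong_sets[OF sPiM refl] .
  have RZ: "R (\<lambda>i\<in>?I. (x i, y i)) = RdCov_sq n h1 h2 x y" for x y
    unfolding R_def by (rule RdCov_sq_cong) simp_all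
  let ?G = "\<lambda>(\<sigma>, \<tau>). dcov_sq n (h1 \<circ> \<sigma>) (h2 \<circ> \<tau>)"
  let ?S = "\<lambda>(x, y). (rank_perm n h1 x, rank_perm n h2 y)"
  have G: "?G \<in> borel_measurable (count_space ?P \<Otimes>\<^sub>M count_space ?P)"
    using fin by (subst pair_measure_countable) (auto intro: countable_finite)
  note [measurable] = measurable_rank_perm_PiM[OF sX, of n h1] measurable_rank_perm_PiM[OF sY, of n h2]
  have S: "?S \<in> measurable (?NX \<Otimes>\<^sub>M ?NY) (count_space ?P \<Otimes>\<^sub>M count_space ?P)"
    by measurable
  have "distr M borel (\<lambda>\<omega>. RdCov_sq n h1 h2 (\<lambda>i. X i \<omega>) (\<lambda>i. Y i \<omega>))
      = distr (distr M (PiM ?I (\<lambda>_. borel)) ?Z) borel R"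
    unfolding distr_distr[OF R Z] comp_def RZ ..
  \<comment> \<open>Independence is expressed as a product form of the joint law. This
    characterisation asks for a nonempty index set, which \<open>n > 0\<close> supplies.\<close>
  also have "distr M (PiM ?I (\<lambda>_. borel)) ?Z = PiM ?I (\<lambda>i. distr M borel (\<lambda>\<omega>. (X i \<omega>, Y i \<omega>)))"
    using iid n rv by (subst M.indep_vars_iff_distr_eq_PiM'[symmetric]) (auto simp: iid_sample_def)
  also have "\<dots> = PiM ?I (\<lambda>_. \<mu>X \<Otimes>\<^sub>M \<mu>Y)"
    using iid by (intro PiM_cong refl) (auto simp: iid_sample_def)
  also have "\<dots> = distr (?NX \<Otimes>\<^sub>M ?NY) (PiM ?I (\<lambda>_. \<mu>X \<Otimes>\<^sub>M \<mu>Y)) (\<lambda>(x, y). \<lambda>i\<in>?I. (x i, y i))"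
    by (intro PiM_pair_measure_eq_distr \<mu>X.prob_space_axioms \<mu>Y.prob_space_axioms) simp
  also have "distr \<dots> borel R = distr (?NX \<Otimes>\<^sub>M ?NY) borel (\<lambda>(x, y). RdCov_sq n h1 h2 x y)"
    by (subst distr_distr[OF R']) (measurable, simp add: comp_def case_prod_beta' RZ del: One_nat_def)
  \<comment> \<open>Outside a null set of ties, the statistic factors through the pair of rank
    permutations.\<close>
  also have "\<dots> = distr (?NX \<Otimes>\<^sub>M ?NY) borel (?G \<circ> ?S)"
  proof (rule distr_cong_AE)
    have "AE z in ?NX \<Otimes>\<^sub>M ?NY. no_ties n h1 (fst z) \<and> no_ties n h2 (snd z)"
    proof (rule XY.AE_pair_measure)
      have "Measurable.pred (?NX \<Otimes>\<^sub>M ?NY) (\<lambda>z. no_ties n h1 (\<lambda>i. fst z i))"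
        "Measurable.pred (?NX \<Otimes>\<^sub>M ?NY) (\<lambda>z. no_ties n h2 (\<lambda>i. snd z i))"
        by (rule pred_no_ties; measurable)+
      then show "{z \<in> space (?NX \<Otimes>\<^sub>M ?NY). no_ties n h1 (fst z) \<and> no_ties n h2 (snd z)}
          \<in> sets (?NX \<Otimes>\<^sub>M ?NY)"
        by measurable
      show "AE x in ?NX. AE y in ?NY. no_ties n h1 (fst (x, y)) \<and> no_ties n h2 (snd (x, y))"
        using AE_no_ties[OF \<mu>X h1] AE_no_ties[OF \<mu>Y h2] by auto
    qed
    then show "AE z in ?NX \<Otimes>\<^sub>M ?NY. (case z of (x, y) \<Rightarrow> RdCov_sq n h1 h2 x y) = (?G \<circ> ?S) z"
      by eventually_elim (auto simp: RdCov_sq_eq_rank_perm)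
    show "(\<lambda>(x, y). RdCov_sq n h1 h2 x y) \<in> borel_measurable (?NX \<Otimes>\<^sub>M ?NY)"
      unfolding case_prod_beta' using measurable_RdCov_sq[where M = "?NX \<Otimes>\<^sub>M ?NY" and
          X = "\<lambda>i z. fst z i" and Y = "\<lambda>i z. snd z i" and n = n and ?h1.0 = h1 and ?h2.0 = h2]
      by measurable
    show "?G \<circ> ?S \<in> borel_measurable (?NX \<Otimes>\<^sub>M ?NY)" by (rule measurable_comp[OF S G])
  qed simp_all
  also have "\<dots> = distr (distr (?NX \<Otimes>\<^sub>M ?NY) (count_space ?P \<Otimes>\<^sub>M count_space ?P) ?S) borel ?G"
    by (rule distr_distr[OF G S, symmetric])
  also have "distr (?NX \<Otimes>\<^sub>M ?NY) (count_space ?P \<Otimes>\<^sub>M count_space ?P) ?S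
      = distr ?NX (count_space ?P) (rank_perm n h1) \<Otimes>\<^sub>M distr ?NY (count_space ?P) (rank_perm n h2)"
  \<comment> \<open>\<open>?S\<close> acts on each component separately, so the image of the product
    measure is the product of the images: the two rank permutations are independent.\<close>
  proof (rule pair_measure_distr[symmetric])
    interpret D: prob_space "distr ?NY (count_space ?P) (rank_perm n h2)"
      by (rule NY.prob_space_distr) measurable
    show "sigma_finite_measure (distr ?NY (count_space ?P) (rank_perm n h2))" by unfold_locales
  qed measurable
  finally show ?thesis unfolding distr_rank_perm[OF \<mu>X h1] distr_rank_perm[OF \<mu>Y h2] .
qed

theorem lemma4p1:
  fixes n :: nat
    and h1 :: "nat \<Rightarrow> real ^ 'd1" and h2 :: "nat \<Rightarrow> real ^ 'd2"
    and M :: "'m measure" and X :: "nat \<Rightarrow> 'm \<Rightarrow> real ^ 'd1" and Y :: "nat \<Rightarrow> 'm \<Rightarrow> real ^ 'd2"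
    and M' :: "'k measure" and X' :: "nat \<Rightarrow> 'k \<Rightarrow> real ^ 'd1" and Y' :: "nat \<Rightarrow> 'k \<Rightarrow> real ^ 'd2"
    and \<mu> \<mu>' :: "((real ^ 'd1) \<times> (real ^ 'd2)) measure"
    and \<mu>X \<mu>X' :: "(real ^ 'd1) measure" and \<mu>Y \<mu>Y' :: "(real ^ 'd2) measure"
  assumes "inj_on h1 {1..n}" and "h1 ` {1..n} \<subseteq> cbox 0 1"
    and "inj_on h2 {1..n}" and "h2 ` {1..n} \<subseteq> cbox 0 1"
    and "prob_space \<mu>" and "sets \<mu> = sets borel"
    and "\<mu>X = distr \<mu> borel fst" and "\<mu>Y = distr \<mu> borel snd"
    and "\<mu>X \<in> P_ac" and "\<mu>Y \<in> P_ac"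
    and "iid_sample M n (\<lambda>i \<omega>. (X i \<omega>, Y i \<omega>)) \<mu>"
    and H0: "\<mu> = \<mu>X \<Otimes>\<^sub>M \<mu>Y"
    and "prob_space \<mu>'" and "sets \<mu>' = sets borel"
    and "\<mu>X' = distr \<mu>' borel fst" and "\<mu>Y' = distr \<mu>' borel snd"
    and "\<mu>X' \<in> P_ac" and "\<mu>Y' \<in> P_ac"
    and "iid_sample M' n (\<lambda>i \<omega>. (X' i \<omega>, Y' i \<omega>)) \<mu>'"
    and H0': "\<mu>' = \<mu>X' \<Otimes>\<^sub>M \<mu>Y'"
  shows "distr M borel (\<lambda>\<omega>. RdCov_sq n h1 h2 (\<lambda>i. X i \<omega>) (\<lambda>i. Y i \<omega>)) =
         distr M' borel (\<lambda>\<omega>. RdCov_sq n h1 h2 (\<lambda>i. X' i \<omega>) (\<lambda>i. Y' i \<omega>))"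
\<comment> \<open>For \<open>n = 0\<close> all sums are empty, so the statistic is constantly 0 and
  both laws are the point mass at 0.\<close>
proof (cases "n = 0")
  case True
  have "prob_space M" "prob_space M'" using assms(11,19) by (simp_all add: iid_sample_def)
  then show ?thesis
    using True by (simp add: RdCov_sq_def prob_space.distr_const)
next
  case False
  then have n: "n > 0" by simp
  have iid: "iid_sample M n (\<lambda>i \<omega>. (X i \<omega>, Y i \<omega>)) (\<mu>X \<Otimes>\<^sub>M \<mu>Y)"
    and iid': "iid_sample M' n (\<lambda>i \<omega>. (X' i \<omega>, Y' i \<omega>)) (\<mu>X' \<Otimes>\<^sub>M \<mu>Y')"
    using assms(11,19) unfolding H0[symmetric] H0'[symmetric] .
  show ?thesis
    using distr_RdCov_sq[OF n assms(1,3) \<open>\<mu>X \<in> P_ac\<close> \<open>\<mu>Y \<in> P_ac\<close> iid]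
      distr_RdCov_sq[OF n assms(1,3) \<open>\<mu>X' \<in> P_ac\<close> \<open>\<mu>Y' \<in> P_ac\<close> iid']
    by simp
qed

end
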